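(* Let $G$ be an edge-colored triangle-free graph on $n$ vertices. If $\delta^c(G)>n/5+3\sqrt{n}$, then $G$ contains a rainbow $C_4$.
   Context: All graphs are finite and simple. An edge-colored graph is a graph with a color assigned to each edge (not necessarily proper). $\delta^c(G)$ is the minimum over vertices $v$ of the number of distinct colors on edges incident to $v$. A subgraph is rainbow if all its edges have pairwise distinct colors. *)

theory Defs
  imports Complex_Main
begin

text \<open>Graphs are nonempty, so that the minimum defining the minimum color degree exists.\<close>
definition simple_graph :: "'a set \<Rightarrow> 'a set set \<Rightarrow> bool" where
  "simple_graph V E \<longleftrightarrow> finite V \<and> V \<noteq> {} \<and> (\<forall>e\<in>E. e \<subseteq> V \<and> card e = 2)"

definition subgraph :: "'a set \<Rightarrow> 'a set set \<Rightarrow> 'a set \<Rightarrow> 'a set set \<Rightarrow> bool" where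
  "subgraph W F V E \<longleftrightarrow> simple_graph W F \<and> W \<subseteq> V \<and> F \<subseteq> E"

text \<open>The graph with vertex set \<open>V\<close> and edge set \<open>E\<close> is isomorphic to the cycle \<open>C\<^sub>k\<close>;
  the list \<open>vs\<close> gives the vertices in cyclic order.\<close>
definition is_cycle_graph :: "nat \<Rightarrow> 'a set \<Rightarrow> 'a set set \<Rightarrow> bool" where
  "is_cycle_graph k V E \<longleftrightarrow> 3 \<le> k \<and>
     (\<exists>vs. distinct vs \<and> length vs = k \<and> V = set vs \<and>
           E = {{vs ! i, vs ! ((i + 1) mod k)} | i. i < k})"

definition triangle_free :: "'a set \<Rightarrow> 'a set set \<Rightarrow> bool" where
  "triangle_free V E \<longleftrightarrow> \<not> (\<exists>W F. subgraph W F V E \<and> is_cycle_graph 3 W F)"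

text \<open>An edge-coloring is an arbitrary function on edges; its values outside the edge set are
  irrelevant.\<close>
definition color_degree :: "'a set set \<Rightarrow> ('a set \<Rightarrow> 'c) \<Rightarrow> 'a \<Rightarrow> nat" where
  "color_degree E c v = card (c ` {e \<in> E. v \<in> e})"

definition min_color_degree :: "'a set \<Rightarrow> 'a set set \<Rightarrow> ('a set \<Rightarrow> 'c) \<Rightarrow> nat" where
  "min_color_degree V E c = Min (color_degree E c ` V)"

definition rainbow :: "'a set set \<Rightarrow> ('a set \<Rightarrow> 'c) \<Rightarrow> bool" where
  "rainbow F c \<longleftrightarrow> inj_on c F"

definition has_rainbow_cycle :: "nat \<Rightarrow> 'a set \<Rightarrow> 'a set set \<Rightarrow> ('a set \<Rightarrow> 'c) \<Rightarrow> bool" where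
  "has_rainbow_cycle k V E c \<longleftrightarrow>
     (\<exists>W F. subgraph W F V E \<and> is_cycle_graph k W F \<and> rainbow F c)"

end

theory Submission
  imports Defs
begin

text \<open>
  Let every vertex \<open>v\<close> choose a set \<open>N v\<close> of \<open>d\<close> neighbours joined to it by distinct colours, and read
  this as a digraph. Suppose first that no directed 4-cycle and no 2-cycle occurs. For an arc \<open>v \<rightarrow> u\<close>,
  count the arcs from \<open>N u\<close> to \<open>N v\<close>: either some \<open>w \<in> N u\<close> has no out-neighbour in \<open>N v\<close>, or there
  is an arc \<open>w \<rightarrow> y\<close> with at least as many in-neighbours of \<open>y\<close> in \<open>N u\<close> as out-neighbours of \<open>w\<close>
  in \<open>N v\<close>. By triangle-freeness and the absence of directed 4-cycles, the in-neighbourhood of \<open>v\<close>, the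
  set \<open>N v \<union> N w\<close>, the in-neighbourhood of \<open>u\<close>, \<open>N y\<close> and the in-neighbours of \<open>y\<close> in \<open>N u\<close> are
  disjoint, so \<open>n \<ge> 3 d + d\<^sup>-(v) + d\<^sup>-(u)\<close>. Averaging over all arcs and using convexity gives
  \<open>n \<ge> 5 d\<close>. In general a directed 4-cycle or a 2-cycle may occur, but a non-rainbow directed 4-cycle has
  two edges of the same colour; since colours at the tail of an arc are distinct, discarding a few
  choices of \<open>w\<close> and \<open>y\<close> costs \<open>O(\<surd>n)\<close> per arc on average. The 2-cycles form a properly coloured
  graph without rainbow \<open>C\<^sub>4\<close>, hence number \<open>O(n\<surd>n)\<close>.
\<close>

section \<open>Double counting in finite relations\<close>

lemma bipartite_edge_degree_le:
  assumes "finite A" "finite B" "card B \<le> card A" "A \<noteq> {}" "\<And>a. a \<in> A \<Longrightarrow> \<exists>b\<in>B. R a b"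
  shows "\<exists>a\<in>A. \<exists>b\<in>B. R a b \<and> card {b \<in> B. R a b} \<le> card {a \<in> A. R a b}"
proof (rule ccontr)
  \<comment> \<open>Otherwise weighting each edge by the reciprocal of its degree in \<open>A\<close> resp. \<open>B\<close> yields \<open>|A| < |B|\<close>.\<close>
  assume *: "\<not> ?thesis"
  define da where "da a = real (card {b \<in> B. R a b})" for a
  define db where "db b = real (card {a \<in> A. R a b})" for b
  have lt: "db b < da a" if "a \<in> A" "b \<in> B" "R a b" for a b
    using * that unfolding da_def db_def by (auto simp: not_le)
  have dbpos: "db b > 0" if "a \<in> A" "b \<in> B" "R a b" for a b
    using that assms(1) unfolding db_def by (auto simp: card_gt_0_iff)
  have dapos: "da a > 0" if "a \<in> A" for a
    using that assms(2,5) unfolding da_def by (auto simp: card_gt_0_iff)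
  have "real (card A) = (\<Sum>a\<in>A. \<Sum>b\<in>{b\<in>B. R a b}. 1 / da a)"
  proof -
    have "(\<Sum>b\<in>{b\<in>B. R a b}. 1 / da a) = 1" if "a \<in> A" for a
      using dapos[OF that] by (simp add: da_def)
    then have "(\<Sum>a\<in>A. \<Sum>b\<in>{b\<in>B. R a b}. 1 / da a) = (\<Sum>a\<in>A. 1)" by (rule sum.cong[OF refl])
    then show ?thesis by simp
  qed
  also have "\<dots> < (\<Sum>a\<in>A. \<Sum>b\<in>{b\<in>B. R a b}. 1 / db b)"
  proof (rule sum_strict_mono)
    fix a assume a: "a \<in> A"
    show "(\<Sum>b\<in>{b\<in>B. R a b}. 1 / da a) < (\<Sum>b\<in>{b\<in>B. R a b}. 1 / db b)"
    proof (rule sum_strict_mono)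
      show "{b\<in>B. R a b} \<noteq> {}" using assms(5)[OF a] by auto
      show "1 / da a < 1 / db x" if "x \<in> {b\<in>B. R a b}" for x
        using lt[OF a] dbpos[OF a] that by (auto intro!: divide_strict_left_mono mult_pos_pos dapos[OF a])
    qed (use assms in auto)
  qed (use assms in auto)
  also have "\<dots> = (\<Sum>b\<in>B. \<Sum>a\<in>{a\<in>A. R a b}. 1 / db b)"
    by (rule sum.swap_restrict) (use assms in auto)
  also have "\<dots> \<le> (\<Sum>b\<in>B. 1)"
    by (rule sum_mono) (simp add: db_def divide_simps)
  finally show False using assms(3) by simp
qed

lemma card_fibre_le_1:
  assumes "finite A" "inj_on k A"
  shows "card {a \<in> A. k a = z} \<le> 1"
proof -
  have "\<forall>a\<in>{a \<in> A. k a = z}. \<forall>b\<in>{a \<in> A. k a = z}. a = b"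
    using assms(2) by (auto dest: inj_onD)
  then show ?thesis
    using assms(1) by (simp add: card_le_Suc0_iff_eq)
qed

text \<open>Injectivity of \<open>k\<close> means that each \<open>x\<close> is counted for at most
  one \<open>a\<close>.\<close>

lemma sum_card_fibres_le:
  assumes "finite A" "finite X" "inj_on k A"
  shows "(\<Sum>a\<in>A. card {x \<in> X. f x = k a}) \<le> card X"
proof -
  have "(\<Sum>a\<in>A. card {x \<in> X. f x = k a}) = (\<Sum>x\<in>X. card {a \<in> A. f x = k a})"
    by (rule sum_multicount_gen) (use assms in auto)
  also have "\<dots> \<le> (\<Sum>x\<in>X. 1)"
  proof (rule sum_mono)
    fix x
    show "card {a \<in> A. f x = k a} \<le> 1"
      using card_fibre_le_1[OF assms(1,3), of "f x"] by (simp add: eq_commute)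
  qed
  finally show ?thesis by simp
qed

text \<open>Markov's inequality for a counting function.\<close>

lemma card_large_values_le:
  fixes g :: "'b \<Rightarrow> nat" and T :: real
  assumes "finite A" "T > 0" "(\<Sum>a\<in>A. g a) \<le> S"
  shows "real (card {a \<in> A. real (g a) > T}) \<le> real S / T"
proof -
  have "real (card {a \<in> A. real (g a) > T}) * T = (\<Sum>a\<in>{a \<in> A. real (g a) > T}. T)" by simp
  also have "\<dots> \<le> (\<Sum>a\<in>{a \<in> A. real (g a) > T}. real (g a))" by (rule sum_mono) auto
  also have "\<dots> \<le> (\<Sum>a\<in>A. real (g a))" by (rule sum_mono2) (use assms in auto)
  also have "\<dots> \<le> real S" using assms(3) by (metis of_nat_le_iff of_nat_sum)
  finally show ?thesis using assms(2) by (simp add: field_simps)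
qed

section \<open>The digraph of chosen neighbours\<close>

text \<open>\<open>y \<in> N x\<close> is the arc \<open>x\<close> \<rightarrow> \<open>y\<close>.
  Colours are distinct at the tail of arcs only. \<open>no_triangle\<close> with equal vertices also
  excludes loops, so the vertices in \<open>not_rainbow\<close> are automatically four distinct
  ones.\<close>

locale rainbow_C4_free =
  fixes V :: "'a set" and adj :: "'a \<Rightarrow> 'a \<Rightarrow> bool" and col :: "'a \<Rightarrow> 'a \<Rightarrow> 'c"
    and N :: "'a \<Rightarrow> 'a set" and d :: nat
  assumes finite_V: "finite V"
    and adj_sym: "adj x y \<Longrightarrow> adj y x"
    and no_triangle: "adj x y \<Longrightarrow> adj y z \<Longrightarrow> \<not> adj x z"
    and col_sym: "col x y = col y x"
    and N_dom: "y \<in> N x \<Longrightarrow> x \<in> V \<and> y \<in> V \<and> adj x y"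
    and card_N: "x \<in> V \<Longrightarrow> card (N x) = d"
    and inj_N: "inj_on (col x) (N x)"
    and not_rainbow: "\<lbrakk>adj x y; adj y z; adj z w; adj w x; x \<noteq> z; y \<noteq> w\<rbrakk> \<Longrightarrow>
      col x y = col y z \<or> col x y = col z w \<or> col x y = col w x \<or>
      col y z = col z w \<or> col y z = col w x \<or> col z w = col w x"
begin

definition in_nbrs :: "'a \<Rightarrow> 'a set" where "in_nbrs v = {x. v \<in> N x}"
text \<open>Dropping the vertices on a 2-cycle with \<open>v\<close> makes this set disjoint from
  \<open>N v\<close>.\<close>

definition strict_in_nbrs :: "'a \<Rightarrow> 'a set" where "strict_in_nbrs v = in_nbrs v - N v"
text \<open>Arcs into \<open>v\<close> may share a colour, so this has no constant bound; only its
  sum over differently coloured arcs is controlled.\<close>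

definition in_count :: "'a \<Rightarrow> 'c \<Rightarrow> nat" where "in_count v k = card {x \<in> in_nbrs v. col x v = k}"
text \<open>Monochromatic directed paths \<open>w\<close> \<rightarrow> \<open>x\<close>
  \<rightarrow> \<open>v\<close>.\<close>

definition mono_paths :: "'a \<Rightarrow> 'a \<Rightarrow> nat"
  where "mono_paths v w = card {x \<in> N w. v \<in> N x \<and> col w x = col x v}"
definition mono_paths_into :: "'a \<Rightarrow> nat" where "mono_paths_into v = (\<Sum>w\<in>V. mono_paths v w)"
text \<open>Monochromatic directed paths \<open>v\<close> \<rightarrow> \<open>y\<close>
  \<rightarrow> \<open>w\<close> whose second arc lies on a 2-cycle.\<close>

definition mono_digons :: "'a \<Rightarrow> 'a \<Rightarrow> nat"
  where "mono_digons v w = card {y \<in> N v. y \<in> N w \<and> w \<in> N y \<and> col v y = col w y}"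

lemma N_sub: "N x \<subseteq> V" using N_dom by auto
lemma finite_N [simp]: "finite (N x)" using finite_subset[OF N_sub finite_V] .
lemma in_nbrs_sub: "in_nbrs x \<subseteq> V" using N_dom by (auto simp: in_nbrs_def)
lemma finite_in_nbrs [simp]: "finite (in_nbrs x)" using finite_subset[OF in_nbrs_sub finite_V] .
lemma finite_strict_in_nbrs [simp]: "finite (strict_in_nbrs x)" by (simp add: strict_in_nbrs_def)

lemma N_adj: "y \<in> N x \<Longrightarrow> adj x y" using N_dom by blast

lemma col_N_eqD: "y \<in> N x \<Longrightarrow> z \<in> N x \<Longrightarrow> col x y = col x z \<Longrightarrow> y = z"
  using inj_N[of x] by (auto dest: inj_onD)

section \<open>Local consequences of having no rainbow 4-cycle\<close>

text \<open>Fix one such \<open>y\<close>. For any other \<open>z\<close>, the cycle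
  \<open>v y w z\<close> has distinct colours at each of its vertices, so two opposite edges agree.
  Each of the two coincidences determines \<open>z\<close>, giving 1 + 1 + 1.\<close>

lemma card_common_N_le:
  assumes "v \<noteq> w"
  shows "card {y \<in> N v \<inter> N w. col v y \<noteq> col w y} \<le> 3"
proof -
  let ?S = "{y \<in> N v \<inter> N w. col v y \<noteq> col w y}"
  show ?thesis
  proof (cases "?S = {}")
    case True
    show ?thesis unfolding True by simp
  next
    case False
    then obtain y where y: "y \<in> ?S" by blast
    let ?X = "{z \<in> N w. col w z = col v y}" and ?Y = "{z \<in> N v. col v z = col w y}"
    have "?S \<subseteq> insert y (?X \<union> ?Y)"
    proof
      fix z assume z: "z \<in> ?S"
      show "z \<in> insert y (?X \<union> ?Y)"
      proof (cases "z = y")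
        case False
        have "adj v y" "adj y w" "adj w z" "adj z v"
          using y z by (auto intro: N_adj adj_sym)
        from not_rainbow[OF this assms] False
        have "col v y = col y w \<or> col v y = col w z \<or> col v y = col z v \<or>
          col y w = col w z \<or> col y w = col z v \<or> col w z = col z v" by auto
        moreover have "col v y \<noteq> col v z" "col w y \<noteq> col w z"
          using y z False col_N_eqD by blast+
        ultimately show ?thesis using y z by (auto simp: col_sym)
      qed simp
    qed
    then have "card ?S \<le> card (insert y (?X \<union> ?Y))" by (rule card_mono[rotated]) simp
    also have "\<dots> \<le> Suc (card (?X \<union> ?Y))" by (rule card_insert_le_m1) auto
    also have "\<dots> \<le> Suc (card ?X + card ?Y)" using card_Un_le by simp
    also have "\<dots> \<le> 3"
      using card_fibre_le_1[OF finite_N inj_N, of w "col v y"] card_fibre_le_1[OF finite_N inj_N, of v "col w y"]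
      by simp
    finally show ?thesis .
  qed
qed

text \<open>Each \<open>x\<close> counted closes a directed cycle \<open>v\<close> \<rightarrow>
  \<open>u\<close> \<rightarrow> \<open>w\<close> \<rightarrow> \<open>x\<close> \<rightarrow>
  \<open>v\<close>, with \<open>x \<noteq> u\<close> by strictness. Of the six colour coincidences
  one is excluded by hypothesis; the other five give the sets below, two of which have at most one
  element.\<close>

lemma card_closing_le:
  assumes "u \<in> N v" "w \<in> N u" "w \<noteq> v" "col u w \<noteq> col v u"
  shows "card (strict_in_nbrs v \<inter> N w) \<le> 2 + in_count v (col v u) + in_count v (col u w) + mono_paths v w"
proof -
  let ?A = "{x \<in> N w. col w x = col v u}" and ?B = "{x \<in> N w. col w x = col u w}"
  let ?C = "{x \<in> in_nbrs v. col x v = col v u}" and ?D = "{x \<in> in_nbrs v. col x v = col u w}"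
  let ?E = "{x \<in> N w. v \<in> N x \<and> col w x = col x v}"
  have "strict_in_nbrs v \<inter> N w \<subseteq> ?A \<union> ?B \<union> ?C \<union> ?D \<union> ?E"
  proof
    fix x assume x: "x \<in> strict_in_nbrs v \<inter> N w"
    have "adj w x" "adj x v" "adj v u" "adj u w" "x \<noteq> u"
      using x assms by (auto simp: strict_in_nbrs_def in_nbrs_def intro: N_adj)
    from not_rainbow[OF this(1-4) assms(3) this(5)] assms(4) x
    show "x \<in> ?A \<union> ?B \<union> ?C \<union> ?D \<union> ?E" by (auto simp: strict_in_nbrs_def in_nbrs_def)
  qed
  then have "card (strict_in_nbrs v \<inter> N w) \<le> card (?A \<union> ?B \<union> ?C \<union> ?D \<union> ?E)" by (rule card_mono[rotated]) simp
  also have "\<dots> \<le> card ?A + card ?B + card ?C + card ?D + card ?E"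
    by (meson card_Un_le order_trans add_le_mono order_refl)
  finally show ?thesis
    using card_fibre_le_1[OF finite_N inj_N, of w "col v u"] card_fibre_le_1[OF finite_N inj_N, of w "col u w"]
    by (simp add: in_count_def mono_paths_def)
qed

section \<open>Sums of the exceptional counts\<close>

lemma sum_in_count_le:
  assumes "A \<subseteq> N x"
  shows "(\<Sum>y\<in>A. in_count v (col x y)) \<le> card (in_nbrs v)"
  unfolding in_count_def
  by (rule sum_card_fibres_le) (use assms inj_N in \<open>auto intro: finite_subset inj_on_subset\<close>)

lemma sum_mono_paths_le: "A \<subseteq> V \<Longrightarrow> (\<Sum>w\<in>A. mono_paths v w) \<le> mono_paths_into v"
  unfolding mono_paths_into_def by (rule sum_mono2) (use finite_V in auto)

text \<open>The first arc of a monochromatic path determines the second, because colours are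
  distinct at the middle vertex; there are \<open>card V * d\<close> arcs.\<close>

lemma sum_mono_paths_into_le: "(\<Sum>v\<in>V. mono_paths_into v) \<le> card V * d"
proof -
  have "(\<Sum>v\<in>V. mono_paths_into v) = (\<Sum>w\<in>V. \<Sum>v\<in>V. mono_paths v w)"
    unfolding mono_paths_into_def by (rule sum.swap)
  also have "\<dots> \<le> (\<Sum>w\<in>V. d)"
  proof (rule sum_mono)
    fix w assume w: "w \<in> V"
    have "(\<Sum>v\<in>V. mono_paths v w) = (\<Sum>x\<in>N w. card {v \<in> V. v \<in> N x \<and> col w x = col x v})"
      unfolding mono_paths_def by (rule sum_multicount_gen) (use finite_V in auto)
    also have "\<dots> \<le> (\<Sum>x\<in>N w. 1)"
    proof (rule sum_mono)
      fix x
      have "{v \<in> V. v \<in> N x \<and> col w x = col x v} = {v \<in> N x. col x v = col w x}"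
        using N_sub by auto
      then show "card {v \<in> V. v \<in> N x \<and> col w x = col x v} \<le> 1"
        using card_fibre_le_1[OF finite_N inj_N] by simp
    qed
    finally show "(\<Sum>v\<in>V. mono_paths v w) \<le> d" using card_N[OF w] by simp
  qed
  finally show ?thesis by simp
qed

text \<open>Given the arc \<open>v\<close> \<rightarrow> \<open>y\<close>, the arc \<open>y\<close>
  \<rightarrow> \<open>w\<close> is determined by its colour.\<close>

lemma sum_mono_digons_le:
  assumes "v \<in> V" "A \<subseteq> V"
  shows "(\<Sum>w\<in>A. mono_digons v w) \<le> d"
proof -
  have "(\<Sum>w\<in>A. mono_digons v w) = (\<Sum>y\<in>N v. card {w \<in> A. y \<in> N w \<and> w \<in> N y \<and> col v y = col w y})"
    unfolding mono_digons_def by (rule sum_multicount_gen) (use finite_subset[OF assms(2) finite_V] in auto)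
  also have "\<dots> \<le> (\<Sum>y\<in>N v. 1)"
  proof (rule sum_mono)
    fix y
    have "card {w \<in> A. y \<in> N w \<and> w \<in> N y \<and> col v y = col w y} \<le> card {w \<in> N y. col y w = col v y}"
      by (rule card_mono) (auto simp: col_sym)
    also have "\<dots> \<le> 1" using card_fibre_le_1[OF finite_N inj_N] .
    finally show "card {w \<in> A. y \<in> N w \<and> w \<in> N y \<and> col v y = col w y} \<le> 1" .
  qed
  finally show ?thesis using card_N[OF assms(1)] by simp
qed

section \<open>Disjoint neighbourhoods\<close>

lemma card_strict_in_nbrs_Un_N:
  assumes "v \<in> V" "w \<in> V"
  shows "card (strict_in_nbrs v) + 2 * d =
    card (strict_in_nbrs v \<union> (N v \<union> N w)) + card (N v \<inter> N w) + card (strict_in_nbrs v \<inter> N w)"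
proof -
  have "strict_in_nbrs v \<inter> (N v \<union> N w) = strict_in_nbrs v \<inter> N w" by (auto simp: strict_in_nbrs_def)
  then have "card (strict_in_nbrs v) + card (N v \<union> N w) = card (strict_in_nbrs v \<union> (N v \<union> N w)) + card (strict_in_nbrs v \<inter> N w)"
    using card_Un_Int[of "strict_in_nbrs v" "N v \<union> N w"] by simp
  moreover have "d + d = card (N v \<union> N w) + card (N v \<inter> N w)"
    using card_Un_Int[of "N v" "N w"] assms by (simp add: card_N)
  ultimately show ?thesis by simp
qed

text \<open>A common neighbour of adjacent vertices would complete a triangle.\<close>

lemma N_disjoint:
  assumes "adj x y" "a \<in> in_nbrs x \<union> N x" shows "a \<notin> in_nbrs y \<union> N y"
proof -
  have "adj x a" using assms(2) by (auto simp: in_nbrs_def intro: N_adj adj_sym)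
  then have "\<not> adj y a" using no_triangle[OF assms(1), of a] by blast
  then show ?thesis by (auto simp: in_nbrs_def intro: N_adj adj_sym)
qed

lemma card_disjoint_le:
  assumes "P \<subseteq> V" "Q \<subseteq> V" "P \<inter> Q = {}"
  shows "card P + card Q \<le> card V"
proof -
  have "card P + card Q = card (P \<union> Q)"
    using assms finite_V by (metis card_Un_disjoint finite_subset)
  also have "\<dots> \<le> card V" using assms finite_V by (auto intro: card_mono)
  finally show ?thesis .
qed

lemma strict_in_nbrs_sub: "strict_in_nbrs x \<subseteq> V" using in_nbrs_sub by (auto simp: strict_in_nbrs_def)

lemma two_d_le_card: "u \<in> N v \<Longrightarrow> 2 * d \<le> card V"
proof -
  assume u: "u \<in> N v"
  have "N v \<inter> N u = {}" using N_disjoint[OF N_adj[OF u]] by blast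
  then have "card (N v) + card (N u) \<le> card V" using card_disjoint_le[OF N_sub N_sub] by blast
  moreover have "card (N v) = d" "card (N u) = d" using N_dom[OF u] card_N by auto
  ultimately show ?thesis by simp
qed

section \<open>The inequality for a single arc\<close>

text \<open>Vertices with an exceptional count above the threshold \<open>T\<close> are discarded;
  by Markov this costs a quotient by \<open>T\<close>, while the remaining ones cost at most
  \<open>T\<close> each time they are used.\<close>

lemma arc_inequality:
  fixes T :: real
  assumes uv: "u \<in> N v" and T: "T > 0"
  shows "real (3 * d + card (strict_in_nbrs v) + card (strict_in_nbrs u)) \<le>
    real (card V) + 10 + real (in_count v (col v u)) + 2 * T
    + real (card (in_nbrs v) + mono_paths_into v + d + card (in_nbrs u)) / T
    + real (card (in_nbrs u) + mono_paths_into u) / T"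
proof -
  have uV: "u \<in> V" and vV: "v \<in> V" and vu: "adj v u" using N_dom[OF uv] by auto
  have NV: "w \<in> V" if "w \<in> N x" for w x using that N_sub by auto
  \<comment> \<open>\<open>g\<close> collects every count depending on \<open>w\<close> that is
    charged later, so that all four share one \<open>T\<close>; \<open>h\<close> does the same for
    the choice of \<open>y\<close>.\<close>
  define g where "g w = in_count v (col u w) + mono_paths v w + mono_digons v w + in_count u (col u w)" for w
  define G where "G = card (in_nbrs v) + mono_paths_into v + d + card (in_nbrs u)"
  define h where "h w y = in_count u (col w y) + mono_paths u y" for w y
  define H where "H = card (in_nbrs u) + mono_paths_into u"
  define Bad where "Bad = {w \<in> N u. w = v \<or> col u w = col v u \<or> real (g w) > T}"
  define A where "A = N u - Bad"
  have finA [simp]: "finite A" by (simp add: A_def)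
  have sumg: "(\<Sum>w\<in>N u. g w) \<le> G"
    using sum_in_count_le[of "N u" u v] sum_mono_paths_le[OF N_sub, of v u] sum_mono_digons_le[OF vV N_sub, of u]
      sum_in_count_le[of "N u" u u]
    by (simp add: g_def G_def sum.distrib)
  have Bad: "real (card Bad) \<le> 2 + G / T"
  proof -
    have "Bad \<subseteq> {v} \<union> {w \<in> N u. col u w = col v u} \<union> {w \<in> N u. real (g w) > T}"
      by (auto simp: Bad_def)
    then have "card Bad \<le> card ({v} \<union> {w \<in> N u. col u w = col v u} \<union> {w \<in> N u. real (g w) > T})"
      by (rule card_mono[rotated]) simp
    also have "\<dots> \<le> card {v} + card {w \<in> N u. col u w = col v u} + card {w \<in> N u. real (g w) > T}"
      by (meson card_Un_le order_trans add_le_mono order_refl)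
    finally show ?thesis
      using card_fibre_le_1[OF finite_N inj_N, of u "col v u"] card_large_values_le[OF finite_N T sumg] by simp
  qed
  have cardA: "card A + card Bad = d"
    using card_Diff_subset[of Bad "N u"] card_mono[OF finite_N, of Bad u]
    by (auto simp: A_def Bad_def card_N uV)
  \<comment> \<open>Shrinking \<open>N v\<close> to the size of \<open>A\<close> allows
    \<open>bipartite_edge_degree_le\<close> to be applied.\<close>
  obtain B where B: "B \<subseteq> N v" "card B = card A"
    using obtain_subset_with_card_n[of "card A" "N v"] cardA card_N[OF vV] by auto
  have finB: "finite B" using B(1) finite_subset finite_N by blast
  \<comment> \<open>An arc that is not reciprocated keeps \<open>w\<close> out of
    \<open>N y\<close>; the colour condition allows \<open>card_closing_le\<close> for
    \<open>u\<close> \<rightarrow> \<open>w\<close> \<rightarrow> \<open>y\<close>.\<close>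
  define R where "R w y \<longleftrightarrow> y \<in> N w \<and> w \<notin> N y \<and> col w y \<noteq> col u w \<and> real (h w y) \<le> T" for w y
  have common: "real (card (N v \<inter> N w)) \<le> card {y \<in> B. R w y} + card Bad + mono_digons v w + 4 + H / T"
    if w: "w \<in> A" for w
  proof -
    \<comment> \<open>\<open>X3\<close> and \<open>X4\<close> cover the \<open>y\<close> that also have an arc back to \<open>w\<close>.\<close>
    let ?X1 = "{y \<in> B. R w y}" and ?X2 = "N v - B"
    let ?X3 = "{y \<in> N v \<inter> N w. col v y \<noteq> col w y}"
    let ?X4 = "{y \<in> N v. y \<in> N w \<and> w \<in> N y \<and> col v y = col w y}"
    let ?X5 = "{y \<in> N w. col w y = col u w}" and ?X6 = "{y \<in> N v \<inter> N w. real (h w y) > T}"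
    have "v \<noteq> w" using w by (auto simp: A_def Bad_def)
    have "N v \<inter> N w \<subseteq> ?X1 \<union> ?X2 \<union> ?X3 \<union> ?X4 \<union> ?X5 \<union> ?X6"
      by (auto simp: R_def)
    then have "card (N v \<inter> N w) \<le> card (?X1 \<union> ?X2 \<union> ?X3 \<union> ?X4 \<union> ?X5 \<union> ?X6)"
      using finB by (intro card_mono) auto
    also have "\<dots> \<le> card ?X1 + card ?X2 + card ?X3 + card ?X4 + card ?X5 + card ?X6"
      by (meson card_Un_le order_trans add_le_mono order_refl)
    finally have *: "card (N v \<inter> N w) \<le> card ?X1 + card ?X2 + card ?X3 + card ?X4 + card ?X5 + card ?X6" .
    \<comment> \<open>The 4 in the bound is 3 for \<open>?X3\<close> plus 1 for \<open>?X5\<close>;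
      \<open>?X6\<close> is bounded by Markov.\<close>
    have "card ?X2 = card Bad"
      using card_Diff_subset[OF finB B(1)] B(2) cardA card_N[OF vV] by simp
    moreover have "card ?X3 \<le> 3" using card_common_N_le[OF \<open>v \<noteq> w\<close>] .
    moreover have "card ?X5 \<le> 1" using card_fibre_le_1[OF finite_N inj_N] .
    moreover have "card ?X6 \<le> H / T"
    proof (rule card_large_values_le[OF _ T])
      show "(\<Sum>y\<in>N v \<inter> N w. h w y) \<le> H"
        using sum_in_count_le[of "N v \<inter> N w" w u] sum_mono_paths_le[of "N v \<inter> N w" u] N_sub[of v]
        by (fastforce simp: h_def H_def sum.distrib)
    qed simp
    ultimately show ?thesis using * unfolding mono_digons_def by linarith
  qed
  \<comment> \<open>The two extra terms on the left are kept in reserve: one pays for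
    \<open>?X4\<close>, the other for closing cycles at \<open>u\<close>.\<close>
  have close: "real (card (strict_in_nbrs v \<inter> N w)) + mono_digons v w + in_count u (col u w) \<le> 2 + in_count v (col v u) + T"
    if w: "w \<in> A" for w
    using card_closing_le[OF uv, of w] w by (auto simp: A_def Bad_def g_def)
  have PQ: "card (strict_in_nbrs v \<union> (N v \<union> N w)) + card (strict_in_nbrs u \<union> N u) \<le> card V" if w: "w \<in> N u" for w
  proof (rule card_disjoint_le)
    show "(strict_in_nbrs v \<union> (N v \<union> N w)) \<inter> (strict_in_nbrs u \<union> N u) = {}"
      using N_disjoint[OF vu] N_disjoint[OF N_adj[OF w]] by (fastforce simp: strict_in_nbrs_def)
  qed (use strict_in_nbrs_sub N_sub in auto)
  have cardQ: "card (strict_in_nbrs u \<union> N u) = card (strict_in_nbrs u) + d"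
    using card_N[OF uV] by (subst card_Un_disjoint) (auto simp: strict_in_nbrs_def)
  have nonneg: "real G / T \<ge> 0" "real H / T \<ge> 0" using T by auto
  have "real (3 * d + card (strict_in_nbrs v) + card (strict_in_nbrs u)) \<le>
      real (card V) + 10 + in_count v (col v u) + 2 * T + G / T + H / T"
  proof (cases "A = {}")
    \<comment> \<open>Here every vertex of \<open>N u\<close> is bad, so \<open>d\<close> itself is
      at most \<open>2 + G / T\<close>.\<close>
    case True
    have "card (strict_in_nbrs v \<union> N v) + card (strict_in_nbrs u \<union> N u) \<le> card V"
      by (rule card_disjoint_le) (use strict_in_nbrs_sub N_sub N_disjoint[OF vu] in \<open>fastforce simp: strict_in_nbrs_def\<close>)+
    moreover have "card (strict_in_nbrs v \<union> N v) = card (strict_in_nbrs v) + d"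
      using card_N[OF vV] by (subst card_Un_disjoint) (auto simp: strict_in_nbrs_def)
    moreover have "card Bad = d" using cardA True by simp
    ultimately show ?thesis using Bad cardQ nonneg T by linarith
  next
    case A: False
    show ?thesis
    proof (cases "\<forall>w\<in>A. \<exists>y\<in>B. R w y")
      \<comment> \<open>Without an \<open>R\<close>-arc from \<open>w\<close>, the sets
        \<open>N v\<close> and \<open>N w\<close> are almost disjoint.\<close>
      case False
      then obtain w where w: "w \<in> A" and "\<forall>y\<in>B. \<not> R w y" by auto
      then have "{y \<in> B. R w y} = {}" by blast
      then have w0: "card {y \<in> B. R w y} = 0" by (simp only: card.empty)
      have wN: "w \<in> N u" using w by (simp add: A_def)
      show ?thesis
        using common[OF w] close[OF w] PQ[OF wN] cardQ card_strict_in_nbrs_Un_N[OF vV NV[OF wN]] Bad nonneg T w0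
        by simp
    next
      case True
      obtain w y where wy: "w \<in> A" "y \<in> B" "R w y"
        and le: "card {y \<in> B. R w y} \<le> card {w \<in> A. R w y}"
        using bipartite_edge_degree_le[OF finA finB _ A, of R] B(2) True by auto
      have wN: "w \<in> N u" and yN: "y \<in> N v" and yw: "y \<in> N w"
        using wy B by (auto simp: A_def R_def)
      \<comment> \<open>The set \<open>?S\<close> lies in \<open>N u\<close> and is disjoint from
        \<open>N y\<close>. Replacing \<open>N u\<close> by \<open>N y \<union> ?S\<close> gains at
        least the number of \<open>R\<close>-arcs from \<open>w\<close> into \<open>B\<close>, which
        pays for the overlap of \<open>N v\<close> and \<open>N w\<close>. The constant is 10 = 4 +
        2 + 2 + 2, from \<open>common\<close>, \<open>close\<close>, \<open>Bad\<close> and closing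
        at \<open>u\<close>.\<close>
      let ?S = "{w \<in> A. R w y}"
      let ?Q = "strict_in_nbrs u \<union> N y \<union> ?S"
      have "card ?Q = card (strict_in_nbrs u \<union> N y) + card ?S"
        by (rule card_Un_disjoint) (auto simp: R_def A_def strict_in_nbrs_def)
      moreover have "card (strict_in_nbrs u) + d = card (strict_in_nbrs u \<union> N y) + card (strict_in_nbrs u \<inter> N y)"
        using card_Un_Int[of "strict_in_nbrs u" "N y"] card_N[OF NV[OF yN]] by simp
      moreover have "y \<noteq> u" using wN wy(3) by (auto simp: R_def)
      then have "card (strict_in_nbrs u \<inter> N y) \<le> 2 + in_count u (col u w) + in_count u (col w y) + mono_paths u y"
        using card_closing_le[OF wN yw] wy(3) by (auto simp: R_def)
      then have "real (card (strict_in_nbrs u \<inter> N y)) \<le> 2 + in_count u (col u w) + T"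
        using wy(3) by (auto simp: R_def h_def)
      moreover have "card (strict_in_nbrs v \<union> (N v \<union> N w)) + card ?Q \<le> card V"
      proof (rule card_disjoint_le)
        have "adj v y" "adj w y" "adj w u" using yN yw wN by (auto intro: N_adj adj_sym)
        then show "(strict_in_nbrs v \<union> (N v \<union> N w)) \<inter> ?Q = {}"
          using N_disjoint[OF vu] N_disjoint[of v y] N_disjoint[of w y] N_disjoint[of w u]
          by (fastforce simp: strict_in_nbrs_def A_def)
      qed (use strict_in_nbrs_sub N_sub in \<open>auto simp: A_def\<close>)
      ultimately show ?thesis
        using common[OF wy(1)] close[OF wy(1)] card_strict_in_nbrs_Un_N[OF vV NV[OF wN]] Bad nonneg T le
        by simp
    qed
  qed
  then show ?thesis by (simp add: G_def H_def)
qed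

section \<open>Arc sums and the graph of 2-cycles\<close>

lemma card_strict_in_nbrs_add: "card (strict_in_nbrs v) + card (N v \<inter> in_nbrs v) = card (in_nbrs v)"
  unfolding strict_in_nbrs_def using card_Int_Diff[of "in_nbrs v" "N v"] by (simp add: Int_commute)

lemma sum_arcs_head:
  fixes f :: "'a \<Rightarrow> real"
  shows "(\<Sum>v\<in>V. \<Sum>u\<in>N v. f u) = (\<Sum>u\<in>V. card (in_nbrs u) * f u)"
proof -
  have "(\<Sum>v\<in>V. \<Sum>u\<in>N v. f u) = (\<Sum>v\<in>V. \<Sum>u\<in>{u \<in> V. u \<in> N v}. f u)"
    by (intro sum.cong refl) (use N_sub in auto)
  also have "\<dots> = (\<Sum>u\<in>V. \<Sum>v\<in>{v \<in> V. u \<in> N v}. f u)"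
    by (rule sum.swap_restrict) (use finite_V in auto)
  also have "\<dots> = (\<Sum>u\<in>V. \<Sum>v\<in>in_nbrs u. f u)"
    by (intro sum.cong refl) (use in_nbrs_sub in \<open>auto simp: in_nbrs_def\<close>)
  finally show ?thesis by simp
qed

lemma sum_card_in_nbrs: "(\<Sum>v\<in>V. real (card (in_nbrs v))) = real (card V) * real d"
  using sum_arcs_head[of "\<lambda>_. 1"] by (simp add: card_N)

lemma card_in_nbrs_le: "card (in_nbrs v) \<le> card V"
  using card_mono[OF finite_V in_nbrs_sub] .

text \<open>Both sides come from counting paths of length two in the symmetric graph of 2-cycles:
  the sum of squared degrees is the sum of codegrees. Two distinct vertices have codegree at most 3,
  since the colouring of this graph is proper.\<close>

lemma sum_digons_sq_le:
  "(\<Sum>v\<in>V. (card (N v \<inter> in_nbrs v))\<^sup>2) \<le> (\<Sum>v\<in>V. card (N v \<inter> in_nbrs v)) + 3 * (card V)\<^sup>2"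
proof -
  define H where "H v = N v \<inter> in_nbrs v" for v
  have sym: "u \<in> H v \<longleftrightarrow> v \<in> H u" for u v by (auto simp: H_def in_nbrs_def)
  have HV: "H v \<subseteq> V" for v using N_sub by (auto simp: H_def)
  have finH [simp]: "finite (H v)" for v by (simp add: H_def)
  have "(\<Sum>v\<in>V. (card (H v))\<^sup>2) = (\<Sum>u\<in>V. \<Sum>v\<in>{v \<in> V. v \<in> H u}. card (H u))"
  proof (rule sum.cong[OF refl])
    fix u
    have "{v \<in> V. v \<in> H u} = H u" using HV by auto
    then show "(card (H u))\<^sup>2 = (\<Sum>v\<in>{v \<in> V. v \<in> H u}. card (H u))"
      by (simp add: power2_eq_square)
  qed
  also have "\<dots> = (\<Sum>v\<in>V. \<Sum>u\<in>{u \<in> V. v \<in> H u}. card (H u))"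
    by (rule sum.swap_restrict) (use finite_V in auto)
  also have "\<dots> = (\<Sum>v\<in>V. \<Sum>w\<in>V. card (H v \<inter> H w))"
  proof (rule sum.cong[OF refl])
    fix v
    have "{u \<in> V. v \<in> H u} = H v" using HV sym by auto
    moreover have "(\<Sum>w\<in>V. card {u \<in> H v. u \<in> H w}) = (\<Sum>u\<in>H v. card (H u))"
    proof (rule sum_multicount_gen)
      have "{i \<in> V. j \<in> H i} = H j" for j using HV sym by auto
      then show "\<forall>j\<in>H v. card {i \<in> V. j \<in> H i} = card (H j)" by simp
    qed (use finite_V in auto)
    moreover have "{u \<in> H v. u \<in> H w} = H v \<inter> H w" for w by auto
    ultimately show "(\<Sum>u\<in>{u \<in> V. v \<in> H u}. card (H u)) = (\<Sum>w\<in>V. card (H v \<inter> H w))" by simp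
  qed
  also have "\<dots> \<le> (\<Sum>v\<in>V. card (H v) + 3 * card V)"
  proof (rule sum_mono)
    fix v assume v: "v \<in> V"
    have "card (H v \<inter> H w) \<le> 3" if "w \<noteq> v" for w
    proof -
      have "H v \<inter> H w \<subseteq> {y \<in> N v \<inter> N w. col v y \<noteq> col w y}"
        using that col_N_eqD by (fastforce simp: H_def in_nbrs_def col_sym)
      then have "card (H v \<inter> H w) \<le> card {y \<in> N v \<inter> N w. col v y \<noteq> col w y}"
        by (rule card_mono[rotated]) simp
      also have "\<dots> \<le> 3" using card_common_N_le[of v w] that by simp
      finally show ?thesis .
    qed
    then have "(\<Sum>w\<in>V - {v}. card (H v \<inter> H w)) \<le> (\<Sum>w\<in>V - {v}. 3)"
      by (intro sum_mono) auto
    also have "\<dots> \<le> 3 * card V" using card_mono[OF finite_V, of "V - {v}"] by simp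
    finally show "(\<Sum>w\<in>V. card (H v \<inter> H w)) \<le> card (H v) + 3 * card V"
      using sum.remove[OF finite_V v, of "\<lambda>w. card (H v \<inter> H w)"] by simp
  qed
  also have "\<dots> = (\<Sum>v\<in>V. card (H v)) + 3 * (card V)\<^sup>2"
    by (simp add: sum.distrib power2_eq_square)
  finally show ?thesis by (simp add: H_def)
qed

lemma sum_digons_le:
  assumes "card V \<ge> 4"
  shows "(\<Sum>v\<in>V. real (card (N v \<inter> in_nbrs v))) \<le> 2 * sqrt (card V) * card V"
proof -
  define T where "T = sqrt (card V)"
  define S where "S = (\<Sum>v\<in>V. real (card (N v \<inter> in_nbrs v)))"
  have T2: "real (card V) = T\<^sup>2" by (simp add: T_def)
  have "T \<ge> 2" unfolding T_def using assms by (intro real_le_rsqrt) simp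
  \<comment> \<open>The tangent to the square function at \<open>2 * T\<close> serves as
    Cauchy-Schwarz and leaves an inequality linear in \<open>S\<close>.\<close>
  have "4 * T * S - 4 * T\<^sup>2 * T\<^sup>2 = (\<Sum>v\<in>V. 4 * T * card (N v \<inter> in_nbrs v) - 4 * T\<^sup>2)"
    by (simp add: S_def sum_subtractf sum_distrib_left T2)
  also have "\<dots> \<le> (\<Sum>v\<in>V. (real (card (N v \<inter> in_nbrs v)))\<^sup>2)"
  proof (rule sum_mono)
    fix v
    have "0 \<le> (real (card (N v \<inter> in_nbrs v)) - 2 * T)\<^sup>2" by simp
    then show "4 * T * card (N v \<inter> in_nbrs v) - 4 * T\<^sup>2 \<le> (real (card (N v \<inter> in_nbrs v)))\<^sup>2"
      by (simp add: power2_diff algebra_simps power2_eq_square)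
  qed
  also have "\<dots> = real (\<Sum>v\<in>V. (card (N v \<inter> in_nbrs v))\<^sup>2)" by simp
  also have "\<dots> \<le> real ((\<Sum>v\<in>V. card (N v \<inter> in_nbrs v)) + 3 * (card V)\<^sup>2)"
    using sum_digons_sq_le of_nat_le_iff by blast
  also have "\<dots> = S + 3 * T\<^sup>2 * T\<^sup>2" by (simp add: S_def T2 power2_eq_square)
  finally have "(4 * T - 1) * S \<le> 7 * T ^ 4" by (simp add: algebra_simps power4_eq_xxxx power2_eq_square)
  also have "7 * T ^ 4 \<le> (4 * T - 1) * (2 * T * T\<^sup>2)"
  proof -
    have "2 * T ^ 3 \<le> T * T ^ 3" using \<open>T \<ge> 2\<close> by (intro mult_right_mono) auto
    then show ?thesis by (simp add: algebra_simps power4_eq_xxxx power3_eq_cube power2_eq_square)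
  qed
  finally have "S \<le> 2 * T * T\<^sup>2" using \<open>T \<ge> 2\<close> by (simp add: mult_le_cancel_left_pos)
  then show ?thesis unfolding T2[symmetric] by (simp only: S_def T_def)
qed

section \<open>Averaging over all arcs\<close>

text \<open>\<open>arc_inequality\<close> is summed over all arcs with \<open>T\<close> equal to the
  root of \<open>card V\<close>, which balances \<open>T\<close> against
  \<open>n / T\<close>.\<close>

lemma five_d_le_card:
  assumes n: "card V \<ge> 4" and d: "d > 0"
  shows "5 * real d \<le> card V + 11 + 25 / 2 * sqrt (card V)"
proof -
  define T where "T = sqrt (card V)"
  define n where "n = real (card V)"
  define S where "S = (\<Sum>v\<in>V. real (card (N v \<inter> in_nbrs v)))"
  have T2: "n = T * T" by (simp add: T_def n_def)
  have T: "T > 0" using n by (auto simp: T_def)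
  define f where "f v = real (card (in_nbrs v))" for v
  define f' where "f' v = real (card (strict_in_nbrs v))" for v
  define m where "m v = real (mono_paths_into v)" for v
  have f0: "0 \<le> f v" "f v \<le> n" "0 \<le> f' v" "0 \<le> m v" "f' v \<le> f v" for v
    using card_in_nbrs_le[of v] card_strict_in_nbrs_add[of v] by (auto simp: f_def f'_def m_def n_def)
  have sf: "sum f V = n * d" using sum_card_in_nbrs by (simp add: f_def n_def)
  have sm: "sum m V \<le> n * d"
    using of_nat_mono[OF sum_mono_paths_into_le, where ?'a = real] by (simp add: m_def n_def)
  have sf': "sum f' V = n * d - S"
  proof -
    have "f' v + real (card (N v \<inter> in_nbrs v)) = f v" for v
      using card_strict_in_nbrs_add[of v] by (metis f_def f'_def of_nat_add)
    then have "sum f' V + S = sum f V" by (simp add: S_def sum.distrib[symmetric])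
    then show ?thesis using sf by simp
  qed
  \<comment> \<open>Convexity through the tangent at the mean in-degree \<open>d\<close>;
    \<open>S\<close> measures the loss from the 2-cycles.\<close>
  have ff': "(\<Sum>u\<in>V. f u * f' u) \<ge> n * d * d - 2 * d * S"
  proof -
    have "n * d * d - 2 * d * S = (\<Sum>u\<in>V. 2 * d * f' u - d * d)"
    proof -
      have "(\<Sum>u\<in>V. 2 * d * f' u - d * d) = 2 * d * sum f' V - n * d * d"
        by (simp add: sum_subtractf sum_distrib_left n_def)
      then show ?thesis by (simp add: sf' algebra_simps)
    qed
    also have "\<dots> \<le> (\<Sum>u\<in>V. f u * f' u)"
    proof (rule sum_mono)
      fix u
      have "0 \<le> (f' u - d)\<^sup>2" by simp
      then have "2 * d * f' u - d * d \<le> f' u * f' u" by (simp add: power2_eq_square algebra_simps)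
      also have "\<dots> \<le> f u * f' u" using f0 by (intro mult_right_mono) auto
      finally show "2 * d * f' u - d * d \<le> f u * f' u" .
    qed
    finally show ?thesis .
  qed
  have ff: "(\<Sum>u\<in>V. f u * f u) \<le> n * (n * d)"
    unfolding sf[symmetric] sum_distrib_left by (intro sum_mono mult_right_mono) (use f0 in auto)
  have fm: "(\<Sum>u\<in>V. f u * m u) \<le> n * (n * d)"
  proof -
    have "(\<Sum>u\<in>V. f u * m u) \<le> n * sum m V"
      unfolding sum_distrib_left by (intro sum_mono mult_right_mono) (use f0 in auto)
    also have "\<dots> \<le> n * (n * d)" using sm by (intro mult_left_mono) (auto simp: n_def)
    finally show ?thesis .
  qed
  have "n * d * (3 * d) + d * sum f' V + (\<Sum>u\<in>V. f u * f' u) = (\<Sum>v\<in>V. \<Sum>u\<in>N v. 3 * d + f' v + f' u)"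
    by (simp add: sum.distrib sum_arcs_head sum_distrib_left[symmetric] card_N n_def f_def distrib_left)
  also have "\<dots> \<le> (\<Sum>v\<in>V. \<Sum>u\<in>N v. (n + 10 + 2 * T + d / T) + in_count v (col v u)
      + (f v + m v) / T + (2 * f u + m u) / T)"
  proof (intro sum_mono)
    fix v u assume "u \<in> N v"
    from arc_inequality[OF this T]
    show "3 * d + f' v + f' u \<le> (n + 10 + 2 * T + d / T) + in_count v (col v u)
      + (f v + m v) / T + (2 * f u + m u) / T"
      by (simp add: f_def f'_def m_def n_def add_divide_distrib)
  qed
  also have "\<dots> = n * d * (n + 10 + 2 * T + d / T) + (\<Sum>v\<in>V. \<Sum>u\<in>N v. real (in_count v (col v u)))
      + d * (\<Sum>v\<in>V. (f v + m v) / T) + (\<Sum>u\<in>V. f u * ((2 * f u + m u) / T))"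
    by (simp add: sum.distrib sum_arcs_head card_N n_def f_def)
      (simp add: sum_distrib_left)
  also have "(\<Sum>v\<in>V. \<Sum>u\<in>N v. real (in_count v (col v u))) \<le> n * d"
  proof -
    have "(\<Sum>v\<in>V. \<Sum>u\<in>N v. real (in_count v (col v u))) \<le> sum f V"
    proof (rule sum_mono)
      fix v
      show "(\<Sum>u\<in>N v. real (in_count v (col v u))) \<le> f v"
        using of_nat_mono[OF sum_in_count_le[OF order_refl, of v v], where ?'a = real] by (simp add: f_def)
    qed
    then show ?thesis using sf by simp
  qed
  also have "d * (\<Sum>v\<in>V. (f v + m v) / T) \<le> n * d * (2 * d / T)"
  proof -
    have "(\<Sum>v\<in>V. (f v + m v) / T) = (sum f V + sum m V) / T"
      by (simp add: sum_divide_distrib[symmetric] sum.distrib)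
    also have "\<dots> \<le> 2 * n * d / T" using sf sm T by (intro divide_right_mono) auto
    finally have "d * (\<Sum>v\<in>V. (f v + m v) / T) \<le> d * (2 * n * d / T)" by (intro mult_left_mono) auto
    then show ?thesis by (simp add: algebra_simps)
  qed
  also have "(\<Sum>u\<in>V. f u * ((2 * f u + m u) / T)) \<le> n * d * (3 * n / T)"
  proof -
    have "(\<Sum>u\<in>V. f u * ((2 * f u + m u) / T)) = (2 * (\<Sum>u\<in>V. f u * f u) + (\<Sum>u\<in>V. f u * m u)) / T"
    proof -
      have "f u * ((2 * f u + m u) / T) = (2 * (f u * f u) + f u * m u) / T" for u
        by (simp add: distrib_left)
      then have "(\<Sum>u\<in>V. f u * ((2 * f u + m u) / T)) = (\<Sum>u\<in>V. (2 * (f u * f u) + f u * m u) / T)"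
        by (simp only:)
      then show ?thesis by (simp add: sum_divide_distrib[symmetric] sum.distrib sum_distrib_left)
    qed
    also have "\<dots> \<le> 3 * (n * (n * d)) / T" using ff fm T by (intro divide_right_mono) auto
    finally show ?thesis by (simp add: algebra_simps)
  qed
  finally have "n * d * (3 * d) + d * (n * d - S) + (n * d * d - 2 * d * S)
      \<le> n * d * (n + 10 + 2 * T + d / T) + n * d + n * d * (2 * d / T) + n * d * (3 * n / T)"
    using ff' sf' by simp
  moreover have "d * S \<le> d * (2 * T * n)"
    using sum_digons_le[OF n] by (intro mult_left_mono) (auto simp: S_def T_def n_def)
  moreover have "n * d * (3 * d) + d * (n * d - S) + (n * d * d - 2 * d * S) = n * d * (5 * d) - 3 * (d * S)"
    by (simp add: algebra_simps)
  moreover have "n * d * (n + 11 + 8 * T + (x + y + z)) =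
      n * d * (n + 10 + 2 * T + x) + n * d + n * d * y + n * d * z + 3 * (d * (2 * T * n))" for x y z :: real
    by (simp add: algebra_simps)
  moreover have "3 * (d + n) / T = d / T + 2 * d / T + 3 * n / T"
    by (simp add: add_divide_distrib distrib_left)
  ultimately have "n * d * (5 * d) \<le> n * d * (n + 11 + 8 * T + 3 * (d + n) / T)"
    by (smt (verit))
  then have *: "5 * d \<le> n + 11 + 8 * T + 3 * (d + n) / T"
    using n d by (subst (asm) mult_le_cancel_left_pos) (auto simp: n_def)
  have "V \<noteq> {}" using n by auto
  then obtain v where "v \<in> V" by blast
  with d obtain u where "u \<in> N v" using card_N[of v] by fastforce
  \<comment> \<open>This turns \<open>3 * (d + n) / T\<close> into at most \<open>9 / 2 * T\<close>,
    and 8 + 9/2 = 25/2.\<close>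
  then have "2 * real d \<le> n" using two_d_le_card[of u v] by (simp add: n_def)
  then have "3 * (d + n) / T \<le> (9 / 2 * n) / T" using T by (intro divide_right_mono) auto
  also have "\<dots> = 9 / 2 * T" using T by (simp add: T2)
  finally have "5 * d \<le> n + 11 + 25 / 2 * T" using * by linarith
  then show ?thesis by (simp add: T_def n_def)
qed

end

section \<open>Cycles and rainbow stars in edge-coloured graphs\<close>

lemma is_cycle_graph_3I:
  assumes "x \<noteq> y" "y \<noteq> z" "x \<noteq> z"
  shows "is_cycle_graph 3 {x, y, z} {{x, y}, {y, z}, {z, x}}"
proof -
  have *: "{{vs ! i, vs ! ((i + 1) mod 3)} | i. i < (3::nat)} =
      {{vs ! 0, vs ! 1}, {vs ! 1, vs ! 2}, {vs ! 2, vs ! 0}}" for vs :: "'a list"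
  proof -
    have "{..<3} = {0, 1, 2::nat}" by auto
    moreover have "{{vs ! i, vs ! ((i + 1) mod 3)} | i. i < (3::nat)} =
        (\<lambda>i. {vs ! i, vs ! ((i + 1) mod 3)}) ` {..<3}" by auto
    ultimately show ?thesis by (simp flip: numeral_2_eq_2)
  qed
  show ?thesis unfolding is_cycle_graph_def *
    by (rule conjI, simp, rule exI[of _ "[x, y, z]"]) (use assms in auto)
qed

lemma is_cycle_graph_4I:
  assumes "distinct [x, y, z, w]"
  shows "is_cycle_graph 4 {x, y, z, w} {{x, y}, {y, z}, {z, w}, {w, x}}"
proof -
  have *: "{{vs ! i, vs ! ((i + 1) mod 4)} | i. i < (4::nat)} =
      {{vs ! 0, vs ! 1}, {vs ! 1, vs ! 2}, {vs ! 2, vs ! 3}, {vs ! 3, vs ! 0}}" for vs :: "'a list"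
  proof -
    have "{..<4} = {0, 1, 2, 3::nat}" by auto
    moreover have "{{vs ! i, vs ! ((i + 1) mod 4)} | i. i < (4::nat)} =
        (\<lambda>i. {vs ! i, vs ! ((i + 1) mod 4)}) ` {..<4}" by auto
    ultimately show ?thesis by (simp flip: numeral_2_eq_2)
  qed
  show ?thesis unfolding is_cycle_graph_def *
    by (rule conjI, simp, rule exI[of _ "[x, y, z, w]"]) (use assms in \<open>auto simp: numeral_3_eq_3\<close>)
qed

lemma subgraphI:
  assumes "simple_graph V E" "F \<subseteq> E" "W = \<Union>F" "F \<noteq> {}"
  shows "subgraph W F V E"
proof -
  have "W \<subseteq> V" "\<forall>e\<in>F. card e = 2" using assms by (auto simp: simple_graph_def)
  moreover have "finite W" using \<open>W \<subseteq> V\<close> assms(1) finite_subset by (auto simp: simple_graph_def)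
  moreover obtain e where e: "e \<in> F" using assms(4) by blast
  then have "e \<noteq> {}" using \<open>\<forall>e\<in>F. card e = 2\<close> by auto
  then have "W \<noteq> {}" using assms(3) e by blast
  moreover have "\<forall>e\<in>F. e \<subseteq> W" using assms(3) by blast
  ultimately show ?thesis using assms(2) unfolding subgraph_def simple_graph_def by blast
qed

text \<open>Pick \<open>d\<close> colours seen at \<open>v\<close> and one edge at \<open>v\<close>
  for each; \<open>S\<close> consists of the other endpoints.\<close>

lemma rainbow_star_exists:
  assumes "simple_graph V E" "v \<in> V" "d \<le> color_degree E c v"
  shows "\<exists>S. (\<forall>u\<in>S. {v, u} \<in> E) \<and> card S = d \<and> inj_on (\<lambda>u. c {v, u}) S"
proof -
  let ?Ev = "{e \<in> E. v \<in> e}"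
  have E: "e \<subseteq> V" "card e = 2" if "e \<in> E" for e using assms(1) that by (auto simp: simple_graph_def)
  obtain C where C: "C \<subseteq> c ` ?Ev" "card C = d" "finite C"
    using obtain_subset_with_card_n[OF assms(3)[unfolded color_degree_def]] by blast
  then obtain F where F: "F \<subseteq> ?Ev" "inj_on c F" "c ` F = C"
    using subset_image_inj[of C c ?Ev] by auto
  define S where "S = {u. {v, u} \<in> F}"
  have im: "(\<lambda>u. {v, u}) ` S = F"
  proof
    show "F \<subseteq> (\<lambda>u. {v, u}) ` S"
    proof
      fix e assume e: "e \<in> F"
      then have "v \<in> e" "card e = 2" using F(1) E by auto
      then obtain u where "e = {v, u}" by (auto simp: card_2_iff)
      then show "e \<in> (\<lambda>u. {v, u}) ` S" using e by (auto simp: S_def)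
    qed
  qed (auto simp: S_def)
  have inj: "inj_on (\<lambda>u. {v, u}) S" by (auto simp: inj_on_def doubleton_eq_iff)
  have "card S = d" using card_image[OF inj] card_image[OF F(2)] im F(3) C(2) by simp
  moreover have "inj_on (c \<circ> (\<lambda>u. {v, u})) S" using comp_inj_on[OF inj] F(2) im by simp
  moreover have "\<forall>u\<in>S. {v, u} \<in> E" using F(1) by (auto simp: S_def)
  ultimately show ?thesis by (auto simp: o_def)
qed

section \<open>Reduction of the coloured graph to the digraph\<close>

theorem theorem4p6:
  fixes V :: "'a set" and E :: "'a set set" and c :: "'a set \<Rightarrow> 'c" and n :: nat
  assumes "simple_graph V E"
    and "card V = n"
    and "triangle_free V E"
    and "real (min_color_degree V E c) > real n / 5 + 3 * sqrt (real n)"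
  shows "has_rainbow_cycle 4 V E c"
proof (rule ccontr)
  assume no_cycle: "\<not> has_rainbow_cycle 4 V E c"
  define d where "d = min_color_degree V E c"
  define adj where "adj x y \<longleftrightarrow> {x, y} \<in> E" for x y
  define col where "col x y = c {x, y}" for x y
  have V: "finite V" "V \<noteq> {}" and E: "\<And>e. e \<in> E \<Longrightarrow> e \<subseteq> V \<and> card e = 2"
    using assms(1) by (auto simp: simple_graph_def)
  have irr: "x \<noteq> y" if "adj x y" for x y
    using E[of "{x, y}"] that by (auto simp: adj_def)
  have "\<exists>S. (\<forall>u\<in>S. adj v u) \<and> card S = d \<and> inj_on (col v) S" if "v \<in> V" for v
  proof -
    have "d \<le> color_degree E c v"
      unfolding d_def min_color_degree_def using V that by (intro Min_le) auto
    from rainbow_star_exists[OF assms(1) that this] show ?thesis by (simp add: adj_def col_def[abs_def])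
  qed
  then obtain N0 where N0: "\<And>v. v \<in> V \<Longrightarrow> (\<forall>u\<in>N0 v. adj v u) \<and> card (N0 v) = d \<and> inj_on (col v) (N0 v)"
    by metis
  \<comment> \<open>The empty default outside \<open>V\<close> makes the domain and injectivity
    conditions hold for every vertex.\<close>
  define N where "N v = (if v \<in> V then N0 v else {})" for v
  interpret rainbow_C4_free V adj col N d
  proof
    show "finite V" by (rule V)
    show "adj y x" if "adj x y" for x y using that by (simp add: adj_def insert_commute)
    show "col x y = col y x" for x y by (simp add: col_def insert_commute)
    show "card (N x) = d" if "x \<in> V" for x using N0 that by (simp add: N_def)
    show "inj_on (col x) (N x)" for x using N0 by (simp add: N_def)
    show "x \<in> V \<and> y \<in> V \<and> adj x y" if "y \<in> N x" for x y
      using that N0[of x] E[of "{x, y}"] by (auto simp: N_def adj_def split: if_splits)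
    show "\<not> adj x z" if "adj x y" "adj y z" for x y z
    proof
      assume xz: "adj x z"
      have "is_cycle_graph 3 {x, y, z} {{x, y}, {y, z}, {z, x}}"
        using that xz irr by (intro is_cycle_graph_3I) auto
      moreover have "subgraph {x, y, z} {{x, y}, {y, z}, {z, x}} V E"
        using that xz by (intro subgraphI[OF assms(1)]) (auto simp: adj_def insert_commute)
      ultimately show False using assms(3) by (auto simp: triangle_free_def)
    qed
    show "col x y = col y z \<or> col x y = col z w \<or> col x y = col w x \<or>
      col y z = col z w \<or> col y z = col w x \<or> col z w = col w x"
      if "adj x y" "adj y z" "adj z w" "adj w x" "x \<noteq> z" "y \<noteq> w" for x y z w
    proof (rule ccontr)
      assume *: "\<not> ?thesis"
      let ?F = "{{x, y}, {y, z}, {z, w}, {w, x}}"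
      have "is_cycle_graph 4 {x, y, z, w} ?F"
        using that irr by (intro is_cycle_graph_4I) auto
      moreover have "subgraph {x, y, z, w} ?F V E"
        using that by (intro subgraphI[OF assms(1)]) (auto simp: adj_def)
      moreover have "rainbow ?F c"
        using * by (auto simp: rainbow_def inj_on_def col_def)
      ultimately show False using no_cycle by (auto simp: has_rainbow_cycle_def)
    qed
  qed
  define T where "T = sqrt n"
  have n: "n > 0" using V assms(2) by auto
  then have T: "T \<ge> 1" and T2: "real n = T * T" by (auto simp: T_def)
  have dT: "real d > real n / 5 + 3 * T" using assms(4) by (simp add: d_def T_def)
  then have "real d > 0" using T by (smt (verit) divide_nonneg_nonneg of_nat_0_le_iff)
  then have d: "d > 0" by simp
  obtain v where v: "v \<in> V" using V by blast
  with d obtain u where "u \<in> N v" using card_N[of v] by fastforce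
  then have "2 * d \<le> n" using two_d_le_card[of u v] assms(2) by simp
  then have "2 * real d \<le> n" by linarith
  \<comment> \<open>From \<open>2 * d \<le> n\<close> and \<open>d > n / 5 + 3 * T\<close>. Then
    \<open>T > 10\<close> secures both \<open>4 \<le> n\<close> and
    \<open>11 + 25 / 2 * T < 15 * T\<close>.\<close>
  then have "10 * T < T * T" using dT T2 T by linarith
  then have "T > 10" using T by simp
  then have "4 \<le> n" using T2 mult_mono[of 2 T 2 T] by simp
  from five_d_le_card[OF _ d] this assms(2) have "5 * real d \<le> n + 11 + 25 / 2 * T"
    by (simp add: T_def)
  then show False using dT \<open>T > 10\<close> by linarith
qed

end
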